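(* Let $G=(V,E)$ be any finite simple undirected graph with $V\neq\emptyset$. Then: (i) for every coalition game $\mathcal G$ over $G$, $\dfrac{\kappa(\mathcal G)}{\kappa^f(\mathcal G)}\le \tau(G)$; (ii) there exists a coalition game $\mathcal G$ over $G$ with $\dfrac{\kappa(\mathcal G)}{\kappa^f(\mathcal G)}\ge \tfrac14\tau(G)$.
   Context: Coalition game over an interaction graph: for a finite simple undirected graph $G=(V,E)$, a coalition game $\mathcal G$ over $G$ is given by a valuation $v:2^V\to\mathbb Z_{\ge 0}$ such that $v(\emptyset)=0$, $v(S)=0$ whenever the induced subgraph $G[S]$ is disconnected, and $v$ is not identically zero. Define $\kappa^f(\mathcal G)=\min\{\sum_{i\in V}x_i : x\in\mathbb R_{\ge0}^V,\ \sum_{i\in S}x_i\ge v(S)\ \forall S\subseteq V\}$ and $\kappa(\mathcal G)$ the same minimum over $x\in\mathbb Z_{\ge 0}^V$. Thicket: a finite collection $\mathcal H$ of nonempty subsets of $V$ such that each member induces a connected subgraph of $G$ and any two members intersect. A hitting set of $\mathcal H$ is a vertex set meeting every member; the hitting size $\tau(\mathcal H)$ is the minimum cardinality of a hitting set. The thicket number $\tau(G)$ is the maximum of $\tau(\mathcal H)$ over all thickets $\mathcal H$ of $G$. *)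

theory Defs
  imports Complex_Main
begin

definition simple_graph :: "'a set \<Rightarrow> ('a \<Rightarrow> 'a \<Rightarrow> bool) \<Rightarrow> bool" where
  "simple_graph V E \<longleftrightarrow> finite V \<and> (\<forall>x y. E x y \<longrightarrow> E y x) \<and> (\<forall>x. \<not> E x x)
     \<and> (\<forall>x y. E x y \<longrightarrow> x \<in> V \<and> y \<in> V)"

definition induced_connected :: "('a \<Rightarrow> 'a \<Rightarrow> bool) \<Rightarrow> 'a set \<Rightarrow> bool" where
  "induced_connected E S \<longleftrightarrow> S \<noteq> {} \<and>
     (\<forall>x\<in>S. \<forall>y\<in>S. (\<lambda>a b. E a b \<and> a \<in> S \<and> b \<in> S)\<^sup>*\<^sup>* x y)"

definition coalition_game :: "'a set \<Rightarrow> ('a \<Rightarrow> 'a \<Rightarrow> bool) \<Rightarrow> ('a set \<Rightarrow> nat) \<Rightarrow> bool" where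
  "coalition_game V E v \<longleftrightarrow> v {} = 0
     \<and> (\<forall>S. S \<subseteq> V \<and> S \<noteq> {} \<and> \<not> induced_connected E S \<longrightarrow> v S = 0)
     \<and> (\<forall>S. \<not> S \<subseteq> V \<longrightarrow> v S = 0)
     \<and> (\<exists>S\<subseteq>V. v S \<noteq> 0)"

definition kappa_f :: "'a set \<Rightarrow> ('a set \<Rightarrow> nat) \<Rightarrow> real" where
  "kappa_f V v = Inf {(\<Sum>i\<in>V. x i) | x :: 'a \<Rightarrow> real.
       (\<forall>i\<in>V. x i \<ge> 0) \<and> (\<forall>S\<subseteq>V. (\<Sum>i\<in>S. x i) \<ge> real (v S))}"

definition kappa :: "'a set \<Rightarrow> ('a set \<Rightarrow> nat) \<Rightarrow> nat" where
  "kappa V v = (LEAST k. \<exists>x :: 'a \<Rightarrow> nat.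
       (\<forall>S\<subseteq>V. (\<Sum>i\<in>S. x i) \<ge> v S) \<and> (\<Sum>i\<in>V. x i) = k)"

definition thicket :: "'a set \<Rightarrow> ('a \<Rightarrow> 'a \<Rightarrow> bool) \<Rightarrow> 'a set set \<Rightarrow> bool" where
  "thicket V E H \<longleftrightarrow> finite H \<and> (\<forall>A\<in>H. A \<noteq> {} \<and> A \<subseteq> V \<and> induced_connected E A)
     \<and> (\<forall>A\<in>H. \<forall>B\<in>H. A \<inter> B \<noteq> {})"

definition hitting_set :: "'a set \<Rightarrow> 'a set set \<Rightarrow> 'a set \<Rightarrow> bool" where
  "hitting_set V H T \<longleftrightarrow> T \<subseteq> V \<and> (\<forall>A\<in>H. T \<inter> A \<noteq> {})"

definition hitting_size :: "'a set \<Rightarrow> 'a set set \<Rightarrow> nat" where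
  "hitting_size V H = (LEAST k. \<exists>T. hitting_set V H T \<and> card T = k)"

definition thicket_number :: "'a set \<Rightarrow> ('a \<Rightarrow> 'a \<Rightarrow> bool) \<Rightarrow> nat" where
  "thicket_number V E = Max (hitting_size V ` {H. thicket V E H})"

end

(* Part (i). A decomposition of G into a tree of bags is used in which every connected vertex set
   occupies a connected set of tree nodes; unlike in a tree decomposition, the two ends of an edge
   may lie in adjacent bags only. By a duality in the style of Bellenbaum and Diestel, G has such a
   decomposition with all bags of size at most tau(G); the use of Menger's theorem in their proof is
   replaced by a direct exchange argument with a minimum hitting set. Eliminating the bags from the
   leaves to the root, a local-ratio argument produces an integral cover x and a family P of
   pairwise disjoint coalitions with x(V) <= tau(G) v(P), and v(P) <= kappa^f by weak duality.

   Part (ii). Let H be a thicket with tau(H) = tau(G) = k, W a minimum hitting set of H, and v the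
   indicator of the connected sets containing more than half of W. The constant weight 2/k on W
   shows kappa^f <= 2. If X with |X| < k/2 met all these sets, the members of H avoiding X would lie
   in one component C of G - X, with |C Int W| <= k/2, so X Un (C Int W) would be a hitting set of H
   with fewer than k elements. Hence kappa >= k/2. *)
theory Submission
  imports Defs "HOL-Library.Disjoint_Sets"
begin

section \<open>Trees of bags\<close>

datatype 'b rtree = Node (bag: 'b) (kids: "'b rtree list")

definition verts :: "'a set rtree \<Rightarrow> 'a set" where
  "verts T = \<Union>(set_rtree T)"

fun subs :: "'b rtree \<Rightarrow> 'b rtree set" where
  "subs (Node X ts) = insert (Node X ts) (\<Union>t\<in>set ts. subs t)"

definition meets :: "'a set \<Rightarrow> 'a set rtree \<Rightarrow> bool" where
  "meets S T \<longleftrightarrow> S \<inter> verts T \<noteq> {}"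

text \<open>\<open>conn S T\<close>: the nodes whose bags meet \<open>S\<close> form a connected subtree of \<open>T\<close>;
  \<open>rconn S T\<close>: moreover, if there are any, then the root is among them.\<close>

fun conn :: "'a set \<Rightarrow> 'a set rtree \<Rightarrow> bool" where
  "conn S (Node X ts) \<longleftrightarrow>
     (\<forall>t\<in>set ts. conn S t \<and> (S \<inter> X \<noteq> {} \<and> meets S t \<longrightarrow> S \<inter> bag t \<noteq> {})) \<and>
     (S \<inter> X = {} \<longrightarrow> length (filter (meets S) ts) \<le> 1)"

definition rconn :: "'a set \<Rightarrow> 'a set rtree \<Rightarrow> bool" where
  "rconn S T \<longleftrightarrow> conn S T \<and> (meets S T \<longrightarrow> S \<inter> bag T \<noteq> {})"

lemma verts_Node [simp]: "verts (Node X ts) = X \<union> (\<Union>t\<in>set ts. verts t)"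
  by (auto simp: verts_def)

lemma meets_Node [simp]: "meets S (Node X ts) \<longleftrightarrow> S \<inter> X \<noteq> {} \<or> (\<exists>t\<in>set ts. meets S t)"
  unfolding meets_def verts_Node by blast

lemma bag_subset_verts: "bag T \<subseteq> verts T"
  by (cases T) auto

lemma set_rtree_subs: "set_rtree T = bag ` subs T"
  by (induction T) auto

lemma verts_subs: "t \<in> subs T \<Longrightarrow> verts t \<subseteq> verts T"
  by (induction T) auto

lemma conn_if_not_meets: "\<not> meets S T \<Longrightarrow> conn S T"
proof (induction T)
  case (Node X ts)
  have "filter (meets S) ts = []"
    using Node.prems by (simp add: filter_empty_conv)
  then show ?case
    using Node by simp
qed

text \<open>If the root bag is met, the bound on the number of kids in \<open>conn\<close> is void;
  if nothing is met, all conditions hold. So \<open>rconn\<close> has a plain recursion, on which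
  the inductions below rely.\<close>

lemma rconn_Node:
  "rconn S (Node X ts) \<longleftrightarrow> (meets S (Node X ts) \<longrightarrow> S \<inter> X \<noteq> {}) \<and> (\<forall>t\<in>set ts. rconn S t)"
proof (cases "meets S (Node X ts)")
  case True
  then show ?thesis
    unfolding rconn_def conn.simps rtree.sel by blast
next
  case False
  then have "\<forall>t\<in>set ts. \<not> meets S t" by auto
  with False show ?thesis
    by (simp add: rconn_def conn_if_not_meets del: meets_Node conn.simps)
qed

lemma rconn_subs: "rconn S T \<Longrightarrow> t \<in> subs T \<Longrightarrow> rconn S t"
  by (induction T) (auto simp: rconn_Node)

lemma meets_Int_verts: "verts T \<subseteq> U \<Longrightarrow> meets (S \<inter> U) T \<longleftrightarrow> meets S T"
  by (auto simp: meets_def)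

lemma rconn_Int_verts: "verts T \<subseteq> U \<Longrightarrow> rconn (S \<inter> U) T \<longleftrightarrow> rconn S T"
proof (induction T)
  case (Node X ts)
  have "rconn (S \<inter> U) t \<longleftrightarrow> rconn S t" if "t \<in> set ts" for t
    proof (rule Node.IH[OF that])
      show "verts t \<subseteq> U" using Node.prems that unfolding verts_Node by blast
    qed
  moreover have "(S \<inter> U) \<inter> X = S \<inter> X"
    using Node.prems by auto
  ultimately show ?case
    using meets_Int_verts[OF Node.prems, of S] by (simp add: rconn_Node del: meets_Node)
qed

lemma meets_Union: "meets (\<Union>\<K>) T \<longleftrightarrow> (\<exists>K\<in>\<K>. meets K T)"
  by (auto simp: meets_def)

text \<open>Fails for \<open>conn\<close>: a union of subtrees is connected here because all of them
  contain the root. This handles vertex sets that are unions of connected pieces without being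
  connected.\<close>

lemma rconn_Union: "(\<And>K. K \<in> \<K> \<Longrightarrow> rconn K T) \<Longrightarrow> rconn (\<Union>\<K>) T"
proof (induction T)
  case (Node X ts)
  have "rconn (\<Union>\<K>) t" if "t \<in> set ts" for t
    using Node that by (simp add: rconn_Node)
  moreover have "meets (\<Union>\<K>) (Node X ts) \<longrightarrow> \<Union>\<K> \<inter> X \<noteq> {}"
    using Node.prems unfolding meets_Union rconn_Node by blast
  ultimately show ?case
    by (simp add: rconn_Node del: meets_Node)
qed

section \<open>Change of the root\<close>

lemma conn_rotate:
  assumes "conn S (Node Y (l @ Node Z m # r))"
  shows "conn S (Node Z (Node Y (l @ r) # m))"
proof -
  let ?n = "\<lambda>ts. length (filter (meets S) ts)"
  have none: "?n xs = 0 \<longleftrightarrow> (\<forall>t\<in>set xs. \<not> meets S t)" for xs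
    by (simp add: filter_empty_conv)
  have len: "S \<inter> Y = {} \<Longrightarrow> ?n l + (if meets S (Node Z m) then 1 else 0) + ?n r \<le> 1"
    using assms by (simp del: meets_Node split: if_splits)
  have kids: "\<forall>t\<in>set (l @ r). conn S t \<and> (S \<inter> Y \<noteq> {} \<and> meets S t \<longrightarrow> S \<inter> bag t \<noteq> {})"
    and ZY: "S \<inter> Y \<noteq> {} \<Longrightarrow> meets S (Node Z m) \<Longrightarrow> S \<inter> Z \<noteq> {}"
    and m: "\<forall>t\<in>set m. conn S t \<and> (S \<inter> Z \<noteq> {} \<and> meets S t \<longrightarrow> S \<inter> bag t \<noteq> {})"
    and lm: "S \<inter> Z = {} \<Longrightarrow> ?n m \<le> 1"
    using assms by (auto simp del: meets_Node)
  \<comment> \<open>A set missing \<open>Y\<close> occurs in at most one branch below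
    \<open>Y\<close>; if that branch is \<open>Node Z m\<close>, the branches that stay below
    \<open>Y\<close> are missed.\<close>
  have sep: "\<not> meets S (Node Y (l @ r))" if "meets S (Node Z m)" "S \<inter> Y = {}"
  proof -
    have "?n l = 0" "?n r = 0" using len that by (simp_all del: meets_Node)
    then show ?thesis using that(2) unfolding none by auto
  qed
  have "conn S (Node Y (l @ r))"
    using kids len by (auto simp del: meets_Node split: if_splits)
  moreover have "S \<inter> Z \<noteq> {} \<Longrightarrow> meets S (Node Y (l @ r)) \<Longrightarrow> S \<inter> Y \<noteq> {}"
    using sep by auto
  moreover have "?n (Node Y (l @ r) # m) \<le> 1" if "S \<inter> Z = {}"
  proof (cases "?n m = 0")
    case True
    then show ?thesis by (simp del: meets_Node)
  next
    case False
    then have "meets S (Node Z m)" unfolding none by auto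
    then have "\<not> meets S (Node Y (l @ r))" using sep ZY that by blast
    then show ?thesis using lm[OF that] by (simp del: meets_Node)
  qed
  ultimately show ?thesis
    using m by (simp del: meets_Node conn.simps add: conn.simps[of S Z])
qed

text \<open>The list \<open>us\<close> holds the part of the tree already turned round: as the root
  moves down towards \<open>Z\<close>, what is left behind becomes an extra kid of the new
  root.\<close>

lemma reroot_aux:
  "Z \<in> set_rtree t \<Longrightarrow>
   \<exists>T'. bag T' = Z \<and> set_rtree T' = set_rtree (Node (bag t) (us @ kids t)) \<and>
        (\<forall>S. conn S (Node (bag t) (us @ kids t)) \<longrightarrow> conn S T')"
proof (induction t arbitrary: us)
  case (Node Y m)
  show ?case
  proof (cases "Z = Y")
    case True
    then show ?thesis by (intro exI[of _ "Node Y (us @ m)"]) simp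
  next
    case False
    then obtain c where c: "c \<in> set m" "Z \<in> set_rtree c"
      using Node.prems by auto
    then obtain l r where m: "m = l @ c # r"
      by (meson split_list)
    obtain T' where T': "bag T' = Z"
      "set_rtree T' = set_rtree (Node (bag c) ([Node Y ((us @ l) @ r)] @ kids c))"
      "\<And>S. conn S (Node (bag c) ([Node Y ((us @ l) @ r)] @ kids c)) \<Longrightarrow> conn S T'"
      using Node.IH[OF c, of "[Node Y ((us @ l) @ r)]"] by blast
    have "set_rtree c = insert (bag c) (\<Union>(set_rtree ` set (kids c)))"
      by (cases c) auto
    then have "set_rtree T' = set_rtree (Node Y (us @ m))"
      unfolding T'(2) m by (auto simp del: rtree.collapse)
    moreover have "conn S T'" if "conn S (Node Y (us @ m))" for S
    proof (rule T'(3))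
      have "conn S (Node Y ((us @ l) @ Node (bag c) (kids c) # r))"
        using that unfolding m rtree.collapse append_assoc .
      then show "conn S (Node (bag c) ([Node Y ((us @ l) @ r)] @ kids c))"
        using conn_rotate[of S Y "us @ l" "bag c" "kids c" r] by (simp only: append.simps)
    qed
    ultimately show ?thesis
      using T'(1) unfolding rtree.sel by blast
  qed
qed

lemma reroot:
  assumes "Z \<in> set_rtree T"
  obtains T' where "bag T' = Z" "set_rtree T' = set_rtree T" "\<And>S. conn S T \<Longrightarrow> conn S T'"
  using reroot_aux[OF assms, of "[]"] by auto

text \<open>If \<open>X \<subseteq> H\<close> and the root bag of \<open>T\<close> misses \<open>H - X\<close>, then \<open>pull X H T\<close> has root bag
  \<open>X\<close> (restricted to the vertices of \<open>T\<close>): each vertex of \<open>X\<close> is added to all bags on the way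
  up to the root.\<close>

fun pull :: "'a set \<Rightarrow> 'a set \<Rightarrow> 'a set rtree \<Rightarrow> 'a set rtree" where
  "pull X H (Node Y ts) = Node (Y \<inter> H \<union> X \<inter> verts (Node Y ts)) (map (pull X H) ts)"

lemma bag_pull: "bag (pull X H T) = bag T \<inter> H \<union> X \<inter> verts T"
  by (cases T) auto

lemma set_rtree_pull: "set_rtree (pull X H T) = (\<lambda>t. bag t \<inter> H \<union> X \<inter> verts t) ` subs T"
  by (induction T) (simp add: image_UN del: verts_Node)

lemma verts_pull:
  assumes "X \<subseteq> H"
  shows "verts (pull X H T) = verts T \<inter> H"
proof -
  have "verts (pull X H T) = (\<Union>t\<in>subs T. bag t \<inter> H \<union> X \<inter> verts t)"
    unfolding verts_def[of "pull X H T"] set_rtree_pull ..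
  also have "\<dots> = (\<Union>t\<in>subs T. bag t) \<inter> H"
  proof (rule equalityI)
    have "verts t \<subseteq> (\<Union>t\<in>subs T. bag t)" if "t \<in> subs T" for t
      using verts_subs[OF that] unfolding verts_def set_rtree_subs .
    then show "(\<Union>t\<in>subs T. bag t \<inter> H \<union> X \<inter> verts t) \<subseteq> (\<Union>t\<in>subs T. bag t) \<inter> H"
      using assms by blast
  qed blast
  finally show ?thesis unfolding verts_def[of T] set_rtree_subs .
qed

text \<open>The critical case is a new bag met only through vertices of \<open>X\<close> copied up
  from below. If the old bag is missed, a single kid contains all of \<open>S\<close> in this
  subtree, so the copied vertex came from that kid and was also copied into its bag.\<close>

lemma conn_pull:
  assumes "X \<subseteq> H" "S \<subseteq> H"
  shows "conn S T \<Longrightarrow> conn S (pull X H T)"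
proof (induction T)
  case (Node Y ts)
  let ?T = "Node Y ts"
  have vp: "meets S (pull X H t) = meets S t" for t
    using verts_pull[OF assms(1)] assms(2) by (auto simp: meets_def)
  have bp: "S \<inter> bag (pull X H t) \<noteq> {} \<longleftrightarrow> S \<inter> bag t \<noteq> {} \<or> meets (S \<inter> X) t" for t
    using assms(2) by (auto simp: bag_pull meets_def)
  have up: "S \<inter> bag (pull X H t) \<noteq> {}"
    if t: "t \<in> set ts" "S \<inter> bag (pull X H ?T) \<noteq> {}" "meets S t" for t
  proof (cases "S \<inter> Y = {}")
    case False
    then show ?thesis using Node.prems t bp by simp
  next
    case True
    then obtain u where u: "u \<in> set ts" "meets (S \<inter> X) u"
      using t(2) unfolding bp by auto
    have "length (filter (meets S) ts) \<le> 1"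
      using Node.prems True by simp
    moreover have "u \<in> set (filter (meets S) ts)" "t \<in> set (filter (meets S) ts)"
      using u t by (auto simp: meets_def)
    ultimately have "u = t"
      by (cases "filter (meets S) ts") auto
    then show ?thesis using u bp by blast
  qed
  have "filter (meets S) (map (pull X H) ts) = map (pull X H) (filter (meets S) ts)"
    by (simp add: filter_map o_def vp)
  moreover have "S \<inter> Y = {}" if "S \<inter> bag (pull X H ?T) = {}"
    using that bp[of ?T] by auto
  ultimately show ?case
    using Node up by (auto simp: vp bag_pull simp del: verts_Node)
qed

section \<open>Connected sets and decompositions\<close>

lemma induced_connectedI:
  assumes sym: "\<And>x y. E x y \<Longrightarrow> E y x" and "z \<in> K"
    and "\<And>a. a \<in> K \<Longrightarrow> (\<lambda>a b. E a b \<and> a \<in> K \<and> b \<in> K)\<^sup>*\<^sup>* z a"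
  shows "induced_connected E K"
proof -
  have "symp (\<lambda>a b. E a b \<and> a \<in> K \<and> b \<in> K)\<^sup>*\<^sup>*"
    using sym by (intro symp_rtranclp) (auto simp: symp_def)
  from sympD[OF this]
  have "(\<lambda>a b. E a b \<and> a \<in> K \<and> b \<in> K)\<^sup>*\<^sup>* a b" if "a \<in> K" "b \<in> K" for a b
    using assms(3)[OF that(1)] assms(3)[OF that(2)] by (blast intro: rtranclp_trans)
  then show ?thesis
    unfolding induced_connected_def using assms(2) by blast
qed

lemma induced_path_mono:
  assumes "(\<lambda>a b. E a b \<and> a \<in> K \<and> b \<in> K)\<^sup>*\<^sup>* x y" "K \<subseteq> L"
  shows "(\<lambda>a b. E a b \<and> a \<in> L \<and> b \<in> L)\<^sup>*\<^sup>* x y"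
  using assms(1) by (rule rtranclp_mono[THEN predicate2D, rotated]) (use assms(2) in auto)

lemma induced_connected_singleton: "induced_connected E {x}"
  by (simp add: induced_connected_def)

lemma induced_connected_Un:
  assumes sym: "\<And>x y. E x y \<Longrightarrow> E y x"
    and "induced_connected E A" "induced_connected E B" "A \<inter> B \<noteq> {}"
  shows "induced_connected E (A \<union> B)"
proof -
  obtain z where z: "z \<in> A" "z \<in> B" using assms(4) by blast
  show ?thesis
  proof (rule induced_connectedI[OF sym])
    fix a assume "a \<in> A \<union> B"
    then consider "(\<lambda>a b. E a b \<and> a \<in> A \<and> b \<in> A)\<^sup>*\<^sup>* z a"
      | "(\<lambda>a b. E a b \<and> a \<in> B \<and> b \<in> B)\<^sup>*\<^sup>* z a"
      using z assms(2,3) unfolding induced_connected_def by blast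
    then show "(\<lambda>a b. E a b \<and> a \<in> A \<union> B \<and> b \<in> A \<union> B)\<^sup>*\<^sup>* z a"
      by cases (erule induced_path_mono, blast)+
  qed (use z in auto)
qed

lemma induced_connected_insert:
  assumes sym: "\<And>x y. E x y \<Longrightarrow> E y x"
    and "induced_connected E K" "z \<in> K" "E y z"
  shows "induced_connected E (insert y K)"
proof -
  have "induced_connected E {z, y}"
    by (rule induced_connectedI[where E=E and z=z, OF sym]) (use assms(4) sym in auto)
  then have "induced_connected E ({z, y} \<union> K)"
    using assms(2,3) by (intro induced_connected_Un[OF sym]) blast+
  moreover have "{z, y} \<union> K = insert y K" using assms(3) by blast
  ultimately show ?thesis by simp
qed

lemma induced_connected_cases:
  assumes "induced_connected E S" "S \<subseteq> U \<union> W" "\<And>u w. u \<in> U \<Longrightarrow> w \<in> W \<Longrightarrow> \<not> E u w"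
  shows "S \<subseteq> U \<or> S \<subseteq> W"
proof (rule disjCI)
  assume "\<not> S \<subseteq> W"
  then obtain x where x: "x \<in> S" "x \<in> U" using assms(2) by blast
  show "S \<subseteq> U"
  proof
    fix y assume "y \<in> S"
    then have "(\<lambda>a b. E a b \<and> a \<in> S \<and> b \<in> S)\<^sup>*\<^sup>* x y"
      using assms(1) x by (simp add: induced_connected_def)
    then show "y \<in> U"
      by induction (use x assms(2,3) in blast)+
  qed
qed

text \<open>Follow a path in \<open>S\<close> from \<open>y\<close> to \<open>X\<close> and stop at
  the first vertex of \<open>X\<close>; until then it stays in \<open>U\<close>, having no edge into
  \<open>W\<close>. So the trace of \<open>S\<close> on \<open>X \<union> U\<close>, though perhaps
  disconnected, is a union of connected sets meeting \<open>X\<close>.\<close>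

lemma connected_piece:
  assumes sym: "\<And>x y. E x y \<Longrightarrow> E y x"
    and S: "induced_connected E S" "S \<inter> X \<noteq> {}" "S \<subseteq> X \<union> U \<union> W"
    and UW: "\<And>u w. u \<in> U \<Longrightarrow> w \<in> W \<Longrightarrow> \<not> E u w"
    and y: "y \<in> S \<inter> (X \<union> U)"
  obtains K where "K \<subseteq> S \<inter> (X \<union> U)" "y \<in> K" "induced_connected E K" "K \<inter> X \<noteq> {}"
proof -
  obtain x where x: "x \<in> S" "x \<in> X" using S(2) by blast
  have "(\<lambda>a b. E a b \<and> a \<in> S \<and> b \<in> S)\<^sup>*\<^sup>* y x"
    using S(1) x y by (simp add: induced_connected_def)
  then have "y \<in> S \<inter> (X \<union> U) \<longrightarrow> (\<exists>K \<subseteq> S \<inter> (X \<union> U). y \<in> K \<and> induced_connected E K \<and> K \<inter> X \<noteq> {})"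
  proof (induction rule: converse_rtranclp_induct)
    case base
    show ?case
      using x by (auto intro!: exI[of _ "{x}"] simp: induced_connected_singleton)
  next
    case (step y z)
    show ?case
    proof
      assume y: "y \<in> S \<inter> (X \<union> U)"
      show "\<exists>K \<subseteq> S \<inter> (X \<union> U). y \<in> K \<and> induced_connected E K \<and> K \<inter> X \<noteq> {}"
      proof (cases "y \<in> X")
        case True
        then show ?thesis
          using y by (intro exI[of _ "{y}"]) (auto simp: induced_connected_singleton)
      next
        case False
        then have "z \<in> S \<inter> (X \<union> U)"
          using y step.hyps(1) UW S(3) by blast
        then obtain K where K: "K \<subseteq> S \<inter> (X \<union> U)" "z \<in> K" "induced_connected E K" "K \<inter> X \<noteq> {}"
          using step.IH by blast
        have "induced_connected E (insert y K)"
          using induced_connected_insert[OF sym K(3,2)] step.hyps(1) by blast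
        then show ?thesis
          using K y by (intro exI[of _ "insert y K"]) auto
      qed
    qed
  qed
  then show ?thesis using that y by blast
qed

section \<open>Components of an induced subgraph\<close>

definition component :: "('a \<Rightarrow> 'a \<Rightarrow> bool) \<Rightarrow> 'a set \<Rightarrow> 'a \<Rightarrow> 'a set" where
  "component E U a = {y. (\<lambda>x y. E x y \<and> x \<in> U \<and> y \<in> U)\<^sup>*\<^sup>* a y}"

lemma component_self: "a \<in> component E U a"
  by (simp add: component_def)

lemma component_subset:
  assumes "a \<in> U"
  shows "component E U a \<subseteq> U"
proof
  fix y assume "y \<in> component E U a"
  then have "(\<lambda>x y. E x y \<and> x \<in> U \<and> y \<in> U)\<^sup>*\<^sup>* a y"
    by (simp add: component_def)
  then show "y \<in> U" by induction (use assms in auto)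
qed

lemma component_closed:
  "\<lbrakk>x \<in> component E U a; a \<in> U; y \<in> U; E x y\<rbrakk> \<Longrightarrow> y \<in> component E U a"
  using component_subset[of a U E] unfolding component_def
  by (auto intro: rtranclp.rtrancl_into_rtrancl)

lemma component_connected:
  assumes sym: "\<And>x y. E x y \<Longrightarrow> E y x" and "a \<in> U"
  shows "induced_connected E (component E U a)"
proof (rule induced_connectedI[OF sym])
  let ?C = "component E U a"
  fix y assume "y \<in> ?C"
  then have "(\<lambda>x y. E x y \<and> x \<in> U \<and> y \<in> U)\<^sup>*\<^sup>* a y"
    by (simp add: component_def)
  then show "(\<lambda>x y. E x y \<and> x \<in> ?C \<and> y \<in> ?C)\<^sup>*\<^sup>* a y"
  proof induction
    case (step y z)
    then have "y \<in> ?C"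
      by (simp add: component_def)
    moreover have "z \<in> ?C"
      using step.hyps unfolding component_def mem_Collect_eq by (rule rtranclp.rtrancl_into_rtrancl)
    moreover note step
    ultimately
    show ?case by (auto intro: rtranclp.rtrancl_into_rtrancl)
  qed simp
qed (auto intro: component_self)

lemma component_absorb:
  assumes "induced_connected E S" "S \<subseteq> U" "S \<inter> component E U a \<noteq> {}" "a \<in> U"
  shows "S \<subseteq> component E U a"
proof -
  have "S \<subseteq> component E U a \<or> S \<subseteq> U - component E U a"
    using assms by (intro induced_connected_cases[of E]) (auto dest: component_closed)
  then show ?thesis using assms(3) by blast
qed

text \<open>For singletons, \<open>conn\<close> is the subtree condition of a tree decomposition.
  For an edge it only forces the subtrees of its two ends to have a connected union, so they share a
  node or contain adjacent nodes.\<close>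

definition vine :: "('a \<Rightarrow> 'a \<Rightarrow> bool) \<Rightarrow> 'a set \<Rightarrow> 'a set rtree \<Rightarrow> bool" where
  "vine E H T \<longleftrightarrow> verts T = H \<and> (\<forall>S\<subseteq>H. induced_connected E S \<longrightarrow> conn S T)"

text \<open>For \<open>B = {}\<close> every bag is bounded by \<open>k\<close>. Enlarging
  \<open>B\<close> relaxes the condition, which is what the induction on thickets exploits.\<close>

definition admissible :: "nat \<Rightarrow> 'a set set \<Rightarrow> 'a set rtree \<Rightarrow> bool" where
  "admissible k B T \<longleftrightarrow> (\<forall>Y\<in>set_rtree T. card Y \<le> k \<or> (\<exists>A\<in>B. A \<inter> Y = {}))"

text \<open>A connected piece of \<open>S\<close> inside \<open>X \<union> U\<close> that meets
  \<open>X\<close> meets the root bag, so its nodes form a subtree through the root. The trace of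
  \<open>S\<close> on \<open>X \<union> U\<close> is a union of such pieces, and \<open>t\<close>
  contains no other vertex of \<open>S\<close>.\<close>

lemma rconn_kids_vine:
  assumes sym: "\<And>x y. E x y \<Longrightarrow> E y x"
    and T: "vine E (X \<union> U) (Node X ts)" "t \<in> set ts"
    and S: "induced_connected E S" "S \<inter> X \<noteq> {}" "S \<subseteq> X \<union> U \<union> W"
    and UW: "\<And>u w. u \<in> U \<Longrightarrow> w \<in> W \<Longrightarrow> \<not> E u w"
  shows "rconn S t"
proof -
  define \<K> where "\<K> = {K. K \<subseteq> S \<inter> (X \<union> U) \<and> induced_connected E K \<and> K \<inter> X \<noteq> {}}"
  have "rconn K t" if "K \<in> \<K>" for K
  proof -
    have "conn K (Node X ts)" "K \<inter> X \<noteq> {}"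
      using that T(1) by (auto simp: \<K>_def vine_def)
    then have "rconn K (Node X ts)"
      by (simp add: rconn_def)
    then show ?thesis using T(2) by (simp add: rconn_Node)
  qed
  then have "rconn (\<Union>\<K>) t" by (rule rconn_Union)
  also have "\<Union>\<K> = S \<inter> (X \<union> U)"
  proof (intro equalityI subsetI)
    fix y assume "y \<in> S \<inter> (X \<union> U)"
    from connected_piece[OF sym S UW this] obtain K
      where "K \<subseteq> S \<inter> (X \<union> U)" "y \<in> K" "induced_connected E K" "K \<inter> X \<noteq> {}" .
    then show "y \<in> \<Union>\<K>" unfolding \<K>_def by blast
  qed (auto simp: \<K>_def)
  finally have "rconn (S \<inter> (X \<union> U)) t" .
  moreover have "verts t \<subseteq> X \<union> U"
    using T unfolding vine_def verts_Node by blast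
  ultimately show ?thesis using rconn_Int_verts by blast
qed

lemma conn_append_not_meets:
  assumes "S \<inter> X = {}" "conn S (Node X ts)" "\<And>t. t \<in> set us \<Longrightarrow> \<not> meets S t"
  shows "conn S (Node X (ts @ us))" "conn S (Node X (us @ ts))"
proof -
  have "filter (meets S) us = []"
    using assms(3) by (simp add: filter_empty_conv)
  then show "conn S (Node X (ts @ us))" "conn S (Node X (us @ ts))"
    using assms conn_if_not_meets by auto
qed

text \<open>A connected set meeting \<open>X\<close> reaches every kid it meets from the root, so
  the two lists of kids do not interfere. One missing \<open>X\<close> lies on one side and meets no
  kid of the other.\<close>

lemma vine_glue:
  assumes sym: "\<And>x y. E x y \<Longrightarrow> E y x"
    and T1: "vine E (X \<union> U) (Node X ts)" and T2: "vine E (X \<union> W) (Node X us)"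
    and UW: "\<And>u w. u \<in> U \<Longrightarrow> w \<in> W \<Longrightarrow> \<not> E u w" and disj: "U \<inter> W = {}"
  shows "vine E (X \<union> (U \<union> W)) (Node X (ts @ us))"
  unfolding vine_def
proof (intro conjI allI impI)
  show "verts (Node X (ts @ us)) = X \<union> (U \<union> W)"
    using T1 T2 unfolding vine_def verts_Node set_append by blast
next
  fix S assume S: "S \<subseteq> X \<union> (U \<union> W)" "induced_connected E S"
  have WU: "\<And>w u. w \<in> W \<Longrightarrow> u \<in> U \<Longrightarrow> \<not> E w u" using UW sym by blast
  show "conn S (Node X (ts @ us))"
  proof (cases "S \<inter> X = {}")
    case False
    have "rconn S t" if "t \<in> set (ts @ us)" for t
    proof (cases "t \<in> set ts")
      case True
      then show ?thesis
        using rconn_kids_vine[OF sym T1 _ S(2) False _ UW] S(1) by blast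
    next
      case f: False
      then show ?thesis
        using rconn_kids_vine[OF sym T2 _ S(2) False _ WU] S(1) that by auto
    qed
    then show ?thesis using False by (simp add: rconn_def)
  next
    case True
    have vts: "verts t \<subseteq> X \<union> U" if "t \<in> set ts" for t
      using that T1 unfolding vine_def verts_Node by blast
    have vus: "verts t \<subseteq> X \<union> W" if "t \<in> set us" for t
      using that T2 unfolding vine_def verts_Node by blast
    have "S \<subseteq> U \<or> S \<subseteq> W"
      using True S by (intro induced_connected_cases[OF S(2) _ UW]) auto
    then show ?thesis
    proof
      assume SU: "S \<subseteq> U"
      then have "conn S (Node X ts)"
        using T1 S(2) unfolding vine_def by blast
      moreover have "\<not> meets S t" if "t \<in> set us" for t
        using vus[OF that] SU True disj unfolding meets_def by blast
      ultimately show ?thesis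
        by (rule conn_append_not_meets(1)[OF True])
    next
      assume SW: "S \<subseteq> W"
      then have "conn S (Node X us)"
        using T2 S(2) unfolding vine_def by blast
      moreover have "\<not> meets S t" if "t \<in> set ts" for t
        using vts[OF that] SW True disj unfolding meets_def by blast
      ultimately show ?thesis
        by (rule conn_append_not_meets(2)[OF True])
    qed
  qed
qed

text \<open>Otherwise exchanging \<open>X \<inter> verts t - bag t\<close> for \<open>bag t - (X \<union> C)\<close> in \<open>X\<close> would give a smaller
  hitting set of \<open>B\<close>.\<close>

lemma card_bag_pull_le:
  assumes sym: "\<And>x y. E x y \<Longrightarrow> E y x"
    and fin: "finite V" and XV: "X \<subseteq> V" and CV: "C \<subseteq> V - X"
    and sep: "\<And>c w. c \<in> C \<Longrightarrow> w \<in> V - X - C \<Longrightarrow> \<not> E c w"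
    and T: "vine E V T" "bag T \<inter> C = {}" and t: "t \<in> subs T"
    and B: "\<And>A. A \<in> B \<Longrightarrow> A \<subseteq> V \<and> induced_connected E A"
    and hitT: "\<And>A. A \<in> B \<Longrightarrow> A \<inter> bag T \<noteq> {}"
    and hitX: "\<And>A. A \<in> B \<Longrightarrow> A \<inter> X \<noteq> {}"
    and min: "\<And>Y. Y \<subseteq> V \<Longrightarrow> (\<forall>A\<in>B. A \<inter> Y \<noteq> {}) \<Longrightarrow> card X \<le> card Y"
  shows "card (bag t \<inter> (X \<union> C) \<union> X \<inter> verts t) \<le> card (bag t)"
proof (rule ccontr)
  assume less: "\<not> ?thesis"
  \<comment> \<open>The new bag arises from \<open>bag t\<close> by gaining \<open>P\<close> and
    losing \<open>Q\<close>. If it grew, \<open>Q\<close> is smaller than \<open>P\<close>, and so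
    \<open>X'\<close> is smaller than \<open>X\<close>.\<close>
  define P where "P = X \<inter> verts t - bag t"
  define Q where "Q = bag t - (X \<union> C)"
  define X' where "X' = (X - P) \<union> Q"
  have tV: "verts t \<subseteq> V" using verts_subs[OF t] T(1) by (simp add: vine_def)
  have bV: "bag t \<subseteq> V" using bag_subset_verts[of t] tV by blast
  have finX: "finite X" and finb: "finite (bag t)"
    using fin XV bV finite_subset by blast+
  have "card (bag t \<inter> (X \<union> C) \<union> X \<inter> verts t) = card (bag t \<inter> (X \<union> C) \<union> P)"
    by (rule arg_cong[of _ _ card]) (auto simp: P_def)
  also have "\<dots> = card (bag t \<inter> (X \<union> C)) + card P"
    using finX finb by (intro card_Un_disjoint) (auto simp: P_def)
  finally have 1: "card (bag t \<inter> (X \<union> C) \<union> X \<inter> verts t) = card (bag t \<inter> (X \<union> C)) + card P" .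
  have "card (bag t) = card (bag t \<inter> (X \<union> C) \<union> Q)"
    by (rule arg_cong[of _ _ card]) (auto simp: Q_def)
  also have "\<dots> = card (bag t \<inter> (X \<union> C)) + card Q"
    using finb by (intro card_Un_disjoint) (auto simp: Q_def)
  finally have PQ: "card Q < card P" using 1 less by simp
  have "card X' \<le> card (X - P) + card Q"
    unfolding X'_def by (rule card_Un_le)
  also have "card (X - P) = card X - card P"
    using finX by (intro card_Diff_subset) (auto simp: P_def intro: finite_subset)
  also have "card P \<le> card X"
    using finX by (intro card_mono) (auto simp: P_def)
  ultimately have "card X' < card X" using PQ by linarith
  moreover have "A \<inter> X' \<noteq> {}" if AB: "A \<in> B" for A
  proof
    assume A0: "A \<inter> X' = {}"
    obtain z where z: "z \<in> A" "z \<in> bag T" using hitT[OF AB] by blast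
    have zV: "z \<in> A \<inter> (X \<union> (V - X - C))"
      using z B[OF AB] T(2) CV by blast
    have A: "induced_connected E A" "A \<inter> X \<noteq> {}" "A \<subseteq> X \<union> (V - X - C) \<union> C"
      using B[OF AB] hitX[OF AB] by blast+
    have sep': "\<not> E w c" if "w \<in> V - X - C" "c \<in> C" for w c
      using sep[OF that(2,1)] sym by blast
    \<comment> \<open>The root bag misses \<open>C\<close>, so \<open>z\<close> lies on the side of
      \<open>X\<close> away from \<open>C\<close>; \<open>K\<close> joins \<open>z\<close> to
      \<open>X\<close> inside \<open>A\<close> without entering \<open>C\<close>.\<close>
    obtain K where
      K: "K \<subseteq> A \<inter> (X \<union> (V - X - C))" "z \<in> K" "induced_connected E K" "K \<inter> X \<noteq> {}"
      using connected_piece[OF sym A sep' zV] by blast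
    have "conn K T" using K B[OF AB] T(1) by (auto simp: vine_def)
    then have "rconn K T" using K z by (auto simp: rconn_def)
    then have "rconn K t" using t by (rule rconn_subs)
    \<comment> \<open>As \<open>A\<close> avoids \<open>X'\<close>, the vertices of \<open>K\<close>
      in \<open>X\<close> belong to \<open>P\<close>, hence occur in \<open>t\<close>.\<close>
    moreover have "meets K t"
    proof -
      obtain x where x: "x \<in> K" "x \<in> X" using K(4) by blast
      then have "x \<in> P" using K(1) A0 by (auto simp: X'_def)
      then show ?thesis using x by (auto simp: P_def meets_def)
    qed
    ultimately obtain w where w: "w \<in> K" "w \<in> bag t"
      by (auto simp: rconn_def)
    \<comment> \<open>A vertex of \<open>bag t\<close> outside \<open>C\<close> lies in
      \<open>X - P\<close> or in \<open>Q\<close>.\<close>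
    then have "w \<in> X'" using K(1) CV by (auto simp: X'_def P_def Q_def)
    then show False using w K(1) A0 by blast
  qed
  moreover have "X' \<subseteq> V" using XV bV by (auto simp: X'_def Q_def)
  ultimately show False using min[of X'] by force
qed

section \<open>Duality between thickets and decompositions\<close>

lemma thicket_insert:
  assumes "thicket V E B" "C \<subseteq> V" "induced_connected E C" "\<And>A. A \<in> B \<Longrightarrow> C \<inter> A \<noteq> {}"
  shows "thicket V E (insert C B)"
  using assms by (auto simp: thicket_def induced_connected_def Int_commute)

text \<open>Treats one component \<open>C\<close> of \<open>V - X\<close>, with root bag
  \<open>X\<close> so that the results can be glued. If \<open>C\<close> misses a member of
  \<open>B\<close>, it may serve as a bag. Otherwise a decomposition for the larger thicket
  \<open>insert C B\<close> is rerooted at a bag hitting all of \<open>B\<close> and cut down to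
  \<open>X \<union> C\<close> by \<open>pull\<close>.\<close>

lemma component_vine:
  assumes sym: "\<And>x y. E x y \<Longrightarrow> E y x" and fin: "finite V" and B: "thicket V E B"
    and XV: "X \<subseteq> V" and hitX: "\<And>A. A \<in> B \<Longrightarrow> A \<inter> X \<noteq> {}" and Xk: "card X \<le> k"
    and min: "\<And>Y. Y \<subseteq> V \<Longrightarrow> (\<forall>A\<in>B. A \<inter> Y \<noteq> {}) \<Longrightarrow> card X \<le> card Y"
    and a: "a \<in> V - X" and C: "C = component E (V - X) a"
    and IH: "thicket V E (insert C B) \<Longrightarrow> \<exists>T. vine E V T \<and> admissible k (insert C B) T"
    and none: "\<nexists>T. vine E V T \<and> admissible k B T"
  shows "\<exists>ts. vine E (X \<union> C) (Node X ts) \<and> admissible k B (Node X ts)"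
proof (cases "thicket V E (insert C B)")
  case False
  have CV: "C \<subseteq> V" "induced_connected E C"
    using component_subset[OF a, of E] component_connected[of E a "V - X"] sym a unfolding C by blast+
  then obtain A where A: "A \<in> B" "C \<inter> A = {}"
    using False thicket_insert[OF B] by blast
  \<comment> \<open>Edges between \<open>X\<close> and \<open>C\<close> need only adjacent bags, so
    no vertex of \<open>X\<close> is added to the bag \<open>C\<close>.\<close>
  have "vine E (X \<union> C) (Node X [Node C []])"
    by (auto simp: vine_def)
  moreover have "admissible k B (Node X [Node C []])"
    using Xk A by (auto simp: admissible_def)
  ultimately show ?thesis by blast
next
  case True
  then obtain T0 where T0: "vine E V T0" "admissible k (insert C B) T0"
    using IH by blast
  then have "\<not> admissible k B T0" using none by blast
  \<comment> \<open>\<open>T0\<close> is not admissible for \<open>B\<close>, so some large bag hits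
    all of \<open>B\<close>; the member of \<open>insert C B\<close> that it misses must then be
    \<open>C\<close>.\<close>
  then obtain Z where Z: "Z \<in> set_rtree T0" "\<not> card Z \<le> k" "\<And>A. A \<in> B \<Longrightarrow> A \<inter> Z \<noteq> {}"
    unfolding admissible_def by blast
  then have ZC: "C \<inter> Z = {}" using T0(2) unfolding admissible_def by blast
  obtain T where T: "bag T = Z" "set_rtree T = set_rtree T0" "\<And>S. conn S T0 \<Longrightarrow> conn S T"
    using reroot[OF Z(1)] by blast
  have vT: "vine E V T"
    using T0(1) T unfolding vine_def verts_def by auto
  have aT: "admissible k (insert C B) T"
    using T0(2) T(2) unfolding admissible_def by simp
  have CV: "C \<subseteq> V - X"
    using component_subset[OF a, of E] C by blast
  have bV: "bag t \<subseteq> V" if "t \<in> subs T" for t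
    using bag_subset_verts[of t] verts_subs[OF that] vT by (auto simp: vine_def)
  have root: "bag T \<inter> (X \<union> C) \<union> X \<inter> verts T = X"
    using vT XV ZC T(1) by (auto simp: vine_def)
  have vine: "vine E (X \<union> C) (pull X (X \<union> C) T)"
    unfolding vine_def
  proof (intro conjI allI impI)
    show "verts (pull X (X \<union> C) T) = X \<union> C"
      using vT CV XV by (subst verts_pull) (auto simp: vine_def)
    fix S assume S: "S \<subseteq> X \<union> C" "induced_connected E S"
    then have "S \<subseteq> V" using XV CV by blast
    then have "conn S T" using vT S(2) unfolding vine_def by blast
    then show "conn S (pull X (X \<union> C) T)"
      using S(1) by (intro conn_pull) auto
  qed
  have adm: "admissible k B (pull X (X \<union> C) T)"
    unfolding admissible_def set_rtree_pull
  proof (intro ballI, elim imageE, hypsubst)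
    fix t assume t: "t \<in> subs T"
    let ?W = "bag t \<inter> (X \<union> C) \<union> X \<inter> verts t"
    have "\<exists>A\<in>B. A \<inter> ?W = {}" if big: "\<not> card ?W \<le> k"
    proof -
      have "card ?W \<le> card (bag t)"
      proof (rule card_bag_pull_le[of E V X C T t B])
        show "\<not> E c w" if "c \<in> C" "w \<in> V - X - C" for c w
          using component_closed[of c E "V - X" a w] that a C by blast
        show "bag T \<inter> C = {}" using ZC T(1) by blast
        show "A \<subseteq> V \<and> induced_connected E A" if "A \<in> B" for A
          using B that by (simp add: thicket_def)
        show "A \<inter> bag T \<noteq> {}" if "A \<in> B" for A
          using Z(3) that T(1) by simp
      qed (fact sym fin XV CV vT t hitX min)+
      then have "\<not> card (bag t) \<le> k" using big by linarith
      then obtain A where A: "A \<in> insert C B" "A \<inter> bag t = {}"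
        using aT t unfolding admissible_def set_rtree_subs by blast
      \<comment> \<open>If the old bag misses \<open>C\<close>, the new one is contained in
        \<open>X\<close> and hence small; so the missed member is one of \<open>B\<close>.\<close>
      have "C \<inter> bag t \<noteq> {}"
      proof
        assume "C \<inter> bag t = {}"
        then have "?W \<subseteq> X" by blast
        then have "card ?W \<le> card X"
          using finite_subset[OF XV fin] by (intro card_mono)
        then show False using big Xk by linarith
      qed
      then have AB: "A \<in> B" using A by blast
      \<comment> \<open>\<open>A\<close> meets the root bag but not \<open>bag t\<close>, so it
        occurs nowhere in the subtree \<open>t\<close>, from which all pulled vertices come.\<close>
      have "\<not> meets A t"
      proof -
        have "conn A T" using B AB vT by (simp add: thicket_def vine_def)
        moreover have "A \<inter> bag T \<noteq> {}" using Z(3)[OF AB] T(1) by simp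
        ultimately have "rconn A T" by (simp add: rconn_def)
        then have "rconn A t" using t by (rule rconn_subs)
        then show ?thesis using A(2) by (simp add: rconn_def)
      qed
      then have "A \<inter> ?W = {}" using A(2) unfolding meets_def by blast
      then show ?thesis using AB by blast
    qed
    then show "card ?W \<le> k \<or> (\<exists>A\<in>B. A \<inter> ?W = {})" by blast
  qed
  have "bag (pull X (X \<union> C) T) = X"
    unfolding bag_pull by (rule root)
  then obtain ts where ts: "pull X (X \<union> C) T = Node X ts"
    by (metis rtree.exhaust_sel)
  show ?thesis using vine adm unfolding ts by blast
qed

text \<open>Duality: the case \<open>B = {}\<close> yields a decomposition all of whose bags have size at most \<open>k\<close>.
  The induction is on larger and larger thickets.\<close>

lemma admissible_vine_exists:
  assumes sym: "\<And>x y. E x y \<Longrightarrow> E y x" and fin: "finite V"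
    and hit: "\<And>H. thicket V E H \<Longrightarrow> \<exists>Y\<subseteq>V. (\<forall>A\<in>H. A \<inter> Y \<noteq> {}) \<and> card Y \<le> k"
  shows "thicket V E B \<Longrightarrow> \<exists>T. vine E V T \<and> admissible k B T"
proof (induction "card (Pow V) - card B" arbitrary: B rule: less_induct)
  case less
  let ?hit = "\<lambda>Y. Y \<subseteq> V \<and> (\<forall>A\<in>B. A \<inter> Y \<noteq> {})"
  obtain Y0 where "?hit Y0" "card Y0 \<le> k" using hit[OF less.prems] by blast
  then obtain X where X: "?hit X" and min: "\<And>Y. ?hit Y \<Longrightarrow> card X \<le> card Y"
    using ex_has_least_nat[of ?hit Y0 card] by blast
  have Xk: "card X \<le> k" using min[OF \<open>?hit Y0\<close>] \<open>card Y0 \<le> k\<close> by linarith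
  show ?case
  proof (rule ccontr)
    assume none: "\<nexists>T. vine E V T \<and> admissible k B T"
    let ?C = "component E (V - X)"
    have piece: "\<exists>ts. vine E (X \<union> ?C a) (Node X ts) \<and> admissible k B (Node X ts)" if a: "a \<in> V - X" for a
    proof (rule component_vine[OF sym fin less.prems _ _ Xk _ a refl _ none])
      assume thk: "thicket V E (insert (?C a) B)"
      \<comment> \<open>\<open>X\<close> hits every member of \<open>B\<close> while the component
        avoids \<open>X\<close>, so the thicket properly grows.\<close>
      have "?C a \<notin> B"
        using component_subset[OF a, of E] X by blast
      moreover have "insert (?C a) B \<subseteq> Pow V"
        using thk by (auto simp: thicket_def)
      moreover have "finite B" using less.prems by (simp add: thicket_def)
      ultimately have "card (insert (?C a) B) = Suc (card B)" "card (insert (?C a) B) \<le> card (Pow V)"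
        using card_mono[of "Pow V" "insert (?C a) B"] fin by (simp_all del: card_Pow)
      then show "\<exists>T. vine E V T \<and> admissible k (insert (?C a) B) T"
        by (intro less.hyps thk) simp
    qed (use X min in auto)
    \<comment> \<open>Components are glued one by one at the common root bag \<open>X\<close>. As
      \<open>D\<close> consists of start vertices, a component may recur and is then
      skipped.\<close>
    have "\<exists>ts. vine E (X \<union> (\<Union>a\<in>D. ?C a)) (Node X ts) \<and> admissible k B (Node X ts)"
      if "finite D" "D \<subseteq> V - X" for D
      using that
    proof (induction D)
      case empty
      have "vine E X (Node X [])" by (auto simp: vine_def)
      moreover have "admissible k B (Node X [])" using Xk by (simp add: admissible_def)
      ultimately show ?case by auto
    next
      case (insert a D)
      then have a: "a \<in> V - X" and D: "D \<subseteq> V - X" by auto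
      let ?U = "\<Union>a\<in>D. ?C a"
      obtain ts where ts: "vine E (X \<union> ?U) (Node X ts)" "admissible k B (Node X ts)"
        using insert by blast
      have absorb: "?C a \<subseteq> ?C b" if "b \<in> D" "?C a \<inter> ?C b \<noteq> {}" for b
      proof (rule component_absorb)
        show "induced_connected E (?C a)" using component_connected[of E a] sym a by blast
        show "?C a \<subseteq> V - X" by (rule component_subset[OF a])
      qed (use that D in auto)
      show ?case
      proof (cases "?C a \<inter> ?U = {}")
        case False
        then have "X \<union> (\<Union>a\<in>insert a D. ?C a) = X \<union> ?U" using absorb by blast
        then show ?thesis using ts by auto
      next
        case True
        obtain us where us: "vine E (X \<union> ?C a) (Node X us)" "admissible k B (Node X us)"
          using piece[OF a] by blast
        have noedge: "\<not> E c w" if "c \<in> ?C a" "w \<in> ?U" for c w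
        proof
          assume "E c w"
          moreover have "w \<in> V - X"
            using that(2) D component_subset[of _ "V - X" E] by blast
          ultimately have "w \<in> ?C a" using component_closed[of c E "V - X" a w] that(1) a by blast
          then show False using True that(2) by blast
        qed
        have "vine E (X \<union> (?C a \<union> ?U)) (Node X (us @ ts))"
          by (rule vine_glue[OF sym us(1) ts(1) noedge True])
        moreover have "admissible k B (Node X (us @ ts))"
          using us(2) ts(2) by (auto simp: admissible_def)
        ultimately show ?thesis by auto
      qed
    qed
    from this[of "V - X"] fin obtain ts
      where ts: "vine E (X \<union> (\<Union>a\<in>V - X. ?C a)) (Node X ts)" "admissible k B (Node X ts)"
      by auto
    have "X \<union> (\<Union>a\<in>V - X. ?C a) = V"
      using X component_subset[of _ "V - X" E] component_self[of _ E "V - X"] by blast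
    then show False using ts none by auto
  qed
qed

section \<open>Covers and packings\<close>

text \<open>An elimination order for the local-ratio argument: the batch \<open>A\<close> is removed
  first and \<open>B\<close> remains. The small set \<open>X\<close> hits all of \<open>A\<close>,
  and a remaining set that misses \<open>X\<close> is disjoint from every member of
  \<open>A\<close>.\<close>

inductive peelable :: "nat \<Rightarrow> 'a set set \<Rightarrow> bool" for k where
  empty: "peelable k {}"
| step: "\<lbrakk>peelable k B; finite X; card X \<le> k; \<And>S. S \<in> A \<Longrightarrow> S \<inter> X \<noteq> {};
     \<And>S R. \<lbrakk>S \<in> A; R \<in> B; S \<inter> R \<noteq> {}\<rbrakk> \<Longrightarrow> R \<inter> X \<noteq> {}\<rbrakk> \<Longrightarrow> peelable k (A \<union> B)"

text \<open>\<open>B\<close> collects the sets that survive the elimination of \<open>T\<close>. At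
  each node the sets inside a single kid and missing the bag \<open>X\<close> go first, then those
  meeting \<open>X\<close>; the derivation is built in the reverse order.\<close>

lemma peelable_vine:
  assumes "\<And>Y. Y \<in> set_rtree T \<Longrightarrow> finite Y \<and> card Y \<le> k"
    and "\<And>S. S \<in> A \<Longrightarrow> conn S T \<and> S \<subseteq> verts T \<and> S \<noteq> {}"
    and "\<And>S. S \<in> B \<Longrightarrow> rconn S T"
    and "peelable k B"
  shows "peelable k (A \<union> B)"
  using assms
proof (induction T arbitrary: A B)
  case (Node X ts)
  define A0 where "A0 = {S\<in>A. S \<inter> X \<noteq> {}}"
  have rA0: "rconn S (Node X ts)" if "S \<in> A0" for S
    using Node.prems(2)[of S] that by (simp add: A0_def rconn_def)
  have base: "peelable k (A0 \<union> B)"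
  proof (rule peelable.step[where X = X])
    fix S R assume *: "S \<in> A0" "R \<in> B" "S \<inter> R \<noteq> {}"
    have "S \<subseteq> verts (Node X ts)" using Node.prems(2)[of S] * by (simp add: A0_def)
    then have "meets R (Node X ts)" using * unfolding meets_def by blast
    then show "R \<inter> X \<noteq> {}" using Node.prems(3)[OF *(2)] by (simp add: rconn_def del: meets_Node)
  qed (use Node.prems in \<open>auto simp: A0_def\<close>)
  \<comment> \<open>Kids are added one after another. Sets inside the kids already added do not
    occur in the current one, so they count as survivors for it.\<close>
  have "peelable k ({S\<in>A. S \<inter> X = {} \<and> (\<exists>t\<in>set us. S \<subseteq> verts t)} \<union> (A0 \<union> B))"
    (is "peelable k (?A us \<union> _)") if "set us \<subseteq> set ts" for us
    using that
  proof (induction us)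
    case Nil
    then show ?case using base by simp
  next
    case (Cons t us)
    have t: "t \<in> set ts" using Cons.prems by simp
    show ?case
    proof (cases "t \<in> set us")
      case True
      then have "?A (t # us) = ?A us" by auto
      then show ?thesis using Cons by simp
    next
      case False
      let ?At = "{S\<in>A. S \<inter> X = {} \<and> S \<subseteq> verts t}"
      have "peelable k (?At \<union> (?A us \<union> (A0 \<union> B)))"
      proof (rule Node.IH[OF t])
        fix S assume S: "S \<in> ?At"
        then show "conn S t \<and> S \<subseteq> verts t \<and> S \<noteq> {}"
          using Node.prems(2)[of S] t by simp
      next
        fix S assume S: "S \<in> ?A us \<union> (A0 \<union> B)"
        show "rconn S t"
        proof (cases "S \<in> A0 \<union> B")
          case True
          then have "rconn S (Node X ts)" using rA0 Node.prems(3) by blast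
          then show ?thesis using t by (simp add: rconn_Node)
        next
          case f: False
          then obtain u where u: "u \<in> set us" "S \<subseteq> verts u" "S \<in> A" "S \<inter> X = {}"
            using S by blast
          have "conn S (Node X ts)" "S \<noteq> {}" using Node.prems(2)[OF u(3)] by auto
          then have len: "length (filter (meets S) ts) \<le> 1" and ct: "conn S t"
            using u(4) t by simp_all
          have "\<not> meets S t"
          proof
            assume "meets S t"
            then have "t \<in> set (filter (meets S) ts)" using t by simp
            moreover have "u \<in> set (filter (meets S) ts)"
              using u(1,2) \<open>S \<noteq> {}\<close> Cons.prems by (auto simp: meets_def)
            ultimately have "u = t"
              using len by (cases "filter (meets S) ts") auto
            then show False using u(1) False by simp
          qed
          then show ?thesis using ct by (simp add: rconn_def)
        qed
      next
        show "peelable k (?A us \<union> (A0 \<union> B))" using Cons by simp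
      qed (use Node.prems(1) t in auto)
      moreover have "?A (t # us) = ?At \<union> ?A us" by auto
      ultimately show ?thesis by (simp add: Un_assoc)
    qed
  qed
  from this[of ts] have "peelable k ({S\<in>A. S \<inter> X = {} \<and> (\<exists>t\<in>set ts. S \<subseteq> verts t)} \<union> (A0 \<union> B))"
    by simp
  moreover have "\<exists>t\<in>set ts. S \<subseteq> verts t" if S: "S \<in> A" "S \<inter> X = {}" for S
  proof -
    have S': "conn S (Node X ts)" "S \<subseteq> X \<union> (\<Union>t\<in>set ts. verts t)" "S \<noteq> {}"
      using Node.prems(2)[OF S(1)] by auto
    then obtain x t where t: "x \<in> S" "t \<in> set ts" "x \<in> verts t" using S(2) by blast
    have "u = t" if "u \<in> set ts" "meets S u" for u
    proof -
      have "length (filter (meets S) ts) \<le> 1" using S'(1) S(2) by simp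
      moreover have "u \<in> set (filter (meets S) ts)" "t \<in> set (filter (meets S) ts)"
        using that t by (auto simp: meets_def)
      ultimately show ?thesis by (cases "filter (meets S) ts") auto
    qed
    then have "S \<subseteq> verts t" using S' S(2) unfolding meets_def by blast
    then show ?thesis using t(2) by blast
  qed
  then have "{S\<in>A. S \<inter> X = {} \<and> (\<exists>t\<in>set ts. S \<subseteq> verts t)} \<union> (A0 \<union> B) = A \<union> B"
    unfolding A0_def by blast
  ultimately show ?case by simp
qed

text \<open>Local ratio: set \<open>A\<close> aside, solve for \<open>B\<close> under a reduced
  valuation \<open>w\<close>, then raise the cover by \<open>r\<close> on \<open>X\<close>. This
  costs at most \<open>k * r\<close>, and the packing can be made to gain at least
  \<open>r\<close>.\<close>

lemma peelable_cover_packing: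
  fixes v :: "'a set \<Rightarrow> nat"
  assumes "peelable k F" and "finite V" and "F \<subseteq> Pow V"
  shows "\<exists>(x :: 'a \<Rightarrow> nat) P. P \<subseteq> F \<and> disjoint P \<and> (\<forall>S\<in>F. v S \<le> sum x S) \<and> sum x V \<le> k * sum v P"
  using assms(1,3)
proof (induction arbitrary: v)
  case empty
  show ?case by (intro exI[of _ "\<lambda>_. 0"] exI[of _ "{}"]) (auto simp: disjoint_def)
next
  case (step B X A)
  have fin: "finite A" "finite B"
    using step.prems assms(2) by (auto intro: finite_subset)
  define r where "r = Max (insert 0 (v ` A))"
  have r: "v S \<le> r" if "S \<in> A" for S
    unfolding r_def using that fin by (intro Max_ge) auto
  \<comment> \<open>The subtraction is truncated: every member of \<open>A\<close> drops to 0, and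
    sets missing \<open>X\<close> keep their value.\<close>
  define w where "w S = (if S \<inter> X \<noteq> {} then v S - r else v S)" for S
  obtain x P where IH: "P \<subseteq> B" "disjoint P" "\<And>S. S \<in> B \<Longrightarrow> w S \<le> sum x S"
    "sum x V \<le> k * sum w P"
    using step.IH[of w] step.prems by blast
  define y where "y i = x i + (if i \<in> X then r else 0)" for i
  have sum_y: "sum y S = sum x S + card (S \<inter> X) * r" if "S \<subseteq> V" for S
  proof -
    have "finite S" using that assms(2) finite_subset by blast
    then have "(\<Sum>i\<in>S. if i \<in> X then r else 0) = card (S \<inter> X) * r"
      by (simp add: sum.If_cases)
    then show ?thesis by (simp add: y_def sum.distrib)
  qed
  have hit_y: "sum x S + r \<le> sum y S" if "S \<subseteq> V" "S \<inter> X \<noteq> {}" for S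
  proof -
    have "finite S" using that(1) assms(2) finite_subset by blast
    then have "1 \<le> card (S \<inter> X)" using that(2) by (simp add: Suc_le_eq card_gt_0_iff)
    then have "1 * r \<le> card (S \<inter> X) * r" by (rule mult_right_mono) simp
    then show ?thesis using sum_y[OF that(1)] by simp
  qed
  have feas: "v S \<le> sum y S" if S: "S \<in> A \<union> B" for S
  proof -
    have SV: "S \<subseteq> V" using S step.prems by blast
    show ?thesis
    proof (cases "S \<inter> X = {}")
      case True
      then have "S \<in> B" using S step.hyps(4) by blast
      then show ?thesis using IH(3)[of S] True sum_y[OF SV] by (simp add: w_def)
    next
      case False
      show ?thesis
      proof (cases "S \<in> A")
        case True
        then show ?thesis using r[OF True] hit_y[OF SV False] by linarith
      next
        case f: False
        then have "w S \<le> sum x S" using S IH(3) by blast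
        then show ?thesis using hit_y[OF SV False] False by (simp add: w_def)
      qed
    qed
  qed
  have cost: "sum y V \<le> k * sum w P + k * r"
  proof -
    have "card (V \<inter> X) \<le> card X" using step.hyps(2) by (intro card_mono) auto
    then have "card (V \<inter> X) * r \<le> k * r" using step.hyps(3) by (intro mult_right_mono) linarith+
    moreover have "sum y V = sum x V + card (V \<inter> X) * r" by (rule sum_y) simp
    ultimately show ?thesis using IH(4) by linarith
  qed
  have finP: "finite P" using IH(1) fin finite_subset by blast
  have wv: "w S \<le> v S" for S by (simp add: w_def)
  \<comment> \<open>A set of positive reduced value in \<open>P\<close> that meets \<open>X\<close>
    supplies the gain \<open>r\<close> itself. If there is none, drop the sets of reduced value 0;
    the others miss \<open>X\<close>, hence are disjoint from a member of \<open>A\<close> of value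
    \<open>r\<close>, which is added.\<close>
  have "\<exists>Q \<subseteq> A \<union> B. disjoint Q \<and> sum w P + r \<le> sum v Q"
  proof (cases "r = 0 \<or> (\<exists>Q\<in>P. Q \<inter> X \<noteq> {} \<and> w Q > 0)")
    case True
    have "sum w P + r \<le> sum v P"
    proof (cases "r = 0")
      case True
      then show ?thesis using wv by (auto intro: sum_mono)
    next
      case False
      then obtain Q where Q: "Q \<in> P" "Q \<inter> X \<noteq> {}" "w Q > 0" using True by blast
      have "w Q + r = v Q" using Q by (simp add: w_def)
      moreover have "sum w (P - {Q}) \<le> sum v (P - {Q})" using wv by (rule sum_mono)
      ultimately show ?thesis
        using sum.remove[OF finP Q(1), of w] sum.remove[OF finP Q(1), of v] by linarith
    qed
    then show ?thesis using IH(1,2) by blast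
  next
    case False
    then have "r \<in> insert 0 (v ` A)" "r \<noteq> 0"
      unfolding r_def using fin Max_in[of "insert 0 (v ` A)"] by auto
    then obtain S0 where S0: "S0 \<in> A" "v S0 = r" by auto
    define P' where "P' = {Q\<in>P. w Q > 0}"
    have PX: "Q \<inter> X = {}" if "Q \<in> P'" for Q
      using False that by (auto simp: P'_def)
    have "S0 \<notin> P'" using PX step.hyps(4) S0 by blast
    have "sum w P = sum w P'"
      unfolding P'_def using finP by (intro sum.mono_neutral_right) auto
    also have "\<dots> = sum v P'"
      by (intro sum.cong) (auto simp: w_def PX)
    finally have "sum w P + r = sum v (insert S0 P')"
      using \<open>S0 \<notin> P'\<close> S0(2) finP by (simp add: P'_def)
    moreover have "disjoint (insert S0 P')"
    proof -
      have "S0 \<inter> Q = {}" if "Q \<in> P'" for Q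
        using step.hyps(5)[OF S0(1), of Q] PX[OF that] that IH(1) by (auto simp: P'_def)
      moreover have "disjoint P'" using IH(2) by (auto simp: P'_def disjoint_def)
      ultimately show ?thesis by (auto simp: disjoint_def Int_commute)
    qed
    moreover have "insert S0 P' \<subseteq> A \<union> B" using S0 IH(1) by (auto simp: P'_def)
    ultimately show ?thesis by (intro exI[of _ "insert S0 P'"]) simp
  qed
  then obtain Q where Q: "Q \<subseteq> A \<union> B" "disjoint Q" "sum w P + r \<le> sum v Q" by blast
  have "sum y V \<le> k * sum v Q"
    using cost mult_le_mono2[OF Q(3), of k] by (simp add: distrib_left)
  then show ?case using Q feas by blast
qed

section \<open>Integral and fractional covers, weak duality\<close>

lemma feasible_exists:
  fixes v :: "'a set \<Rightarrow> nat"
  assumes "finite V" "v {} = 0"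
  shows "\<exists>x :: 'a \<Rightarrow> nat. \<forall>S\<subseteq>V. v S \<le> sum x S"
proof (intro exI[of _ "\<lambda>_. sum v (Pow V)"] allI impI)
  fix S assume S: "S \<subseteq> V"
  show "v S \<le> (\<Sum>i\<in>S. sum v (Pow V))"
  proof (cases "S = {}")
    case False
    have "finite S" using S assms(1) finite_subset by blast
    then have "1 \<le> card S" using False by (simp add: Suc_le_eq card_gt_0_iff)
    then have "1 * sum v (Pow V) \<le> card S * sum v (Pow V)"
      by (rule mult_right_mono) simp
    moreover have "v S \<le> sum v (Pow V)"
      using S assms(1) by (intro member_le_sum) auto
    ultimately show ?thesis by (simp only: sum_constant mult_1 of_nat_id)
  qed (simp add: assms)
qed

lemma kappa_attained:
  fixes v :: "'a set \<Rightarrow> nat"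
  assumes "finite V" "v {} = 0"
  obtains x :: "'a \<Rightarrow> nat" where "\<And>S. S \<subseteq> V \<Longrightarrow> v S \<le> sum x S" "sum x V = kappa V v"
proof -
  have "\<exists>k. \<exists>x :: 'a \<Rightarrow> nat. (\<forall>S\<subseteq>V. v S \<le> sum x S) \<and> sum x V = k"
    using feasible_exists[of V v] assms by blast
  from LeastI_ex[OF this] show ?thesis
    using that unfolding kappa_def by blast
qed

lemma kappa_le:
  assumes "\<And>S. S \<subseteq> V \<Longrightarrow> v S \<le> sum x S"
  shows "kappa V v \<le> sum x V"
  unfolding kappa_def by (rule Least_le) (use assms in blast)

lemma kappa_f_le:
  assumes "\<And>i. i \<in> V \<Longrightarrow> 0 \<le> x i" "\<And>S. S \<subseteq> V \<Longrightarrow> real (v S) \<le> sum x S"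
  shows "kappa_f V v \<le> sum x V"
  unfolding kappa_f_def
proof (rule cInf_lower)
  show "bdd_below {sum x V |x. (\<forall>i\<in>V. 0 \<le> x i) \<and> (\<forall>S\<subseteq>V. real (v S) \<le> sum x S)}"
    by (rule bdd_belowI[of _ 0]) (auto intro: sum_nonneg)
qed (use assms in blast)

lemma kappa_f_ge:
  fixes v :: "'a set \<Rightarrow> nat"
  assumes "finite V" "v {} = 0"
    and "\<And>x :: 'a \<Rightarrow> real. (\<And>i. i \<in> V \<Longrightarrow> 0 \<le> x i) \<Longrightarrow> (\<And>S. S \<subseteq> V \<Longrightarrow> real (v S) \<le> sum x S) \<Longrightarrow> c \<le> sum x V"
  shows "c \<le> kappa_f V v"
  unfolding kappa_f_def
proof (rule cInf_greatest)
  \<comment> \<open>The infimum is bounded below by \<open>c\<close> only if some cover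
    exists.\<close>
  obtain x :: "'a \<Rightarrow> nat" where x: "\<forall>S\<subseteq>V. v S \<le> sum x S"
    using feasible_exists[of V v] assms by blast
  have "real (v S) \<le> (\<Sum>i\<in>S. real (x i))" if "S \<subseteq> V" for S
    using x that unfolding of_nat_sum[symmetric] of_nat_le_iff by blast
  then show "{sum x V |x. (\<forall>i\<in>V. 0 \<le> x i) \<and> (\<forall>S\<subseteq>V. real (v S) \<le> sum x S)} \<noteq> {}"
    by (auto intro!: exI[of _ "\<lambda>i. real (x i)"])
qed (use assms(3) in blast)

text \<open>Weak duality: disjoint coalitions are paid for by disjoint parts of
  \<open>V\<close>.\<close>

lemma packing_le_kappa_f:
  fixes v :: "'a set \<Rightarrow> nat"
  assumes "finite V" "v {} = 0" "P \<subseteq> Pow V" "disjoint P"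
  shows "real (sum v P) \<le> kappa_f V v"
proof (rule kappa_f_ge)
  fix x :: "'a \<Rightarrow> real"
  assume x: "\<And>i. i \<in> V \<Longrightarrow> 0 \<le> x i" "\<And>S. S \<subseteq> V \<Longrightarrow> real (v S) \<le> sum x S"
  have fin: "finite S" if "S \<in> P" for S
    using that assms(1,3) by (auto intro: finite_subset)
  have "real (sum v P) \<le> (\<Sum>S\<in>P. sum x S)"
    unfolding of_nat_sum using assms(3) by (intro sum_mono x(2)) auto
  also have "\<dots> = sum x (\<Union>P)"
    using assms(4) fin by (subst sum.Union_disjoint) (auto simp: disjoint_def)
  also have "\<dots> \<le> sum x V"
    using assms(1,3) x(1) by (intro sum_mono2) auto
  finally show "real (sum v P) \<le> sum x V" .
qed (fact assms)+

section \<open>The thicket number\<close>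

lemma thicket_subset_Pow: "thicket V E H \<Longrightarrow> H \<subseteq> Pow V"
  by (auto simp: thicket_def)

lemma hitting_size_attained:
  assumes "thicket V E H"
  obtains Y where "hitting_set V H Y" "card Y = hitting_size V H"
proof -
  have "hitting_set V H V"
    using assms by (auto simp: thicket_def hitting_set_def Int_absorb1)
  then have "\<exists>k Y. hitting_set V H Y \<and> card Y = k" by blast
  from LeastI_ex[OF this] show ?thesis
    using that unfolding hitting_size_def by blast
qed

lemma hitting_size_le: "hitting_set V H Y \<Longrightarrow> hitting_size V H \<le> card Y"
  unfolding hitting_size_def by (rule Least_le) blast

lemma finite_hitting_sizes: "finite V \<Longrightarrow> finite (hitting_size V ` {H. thicket V E H})"
  by (rule finite_imageI, rule finite_subset[of _ "Pow (Pow V)"]) (auto dest: thicket_subset_Pow)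

lemma hitting_size_le_thicket_number:
  "finite V \<Longrightarrow> thicket V E H \<Longrightarrow> hitting_size V H \<le> thicket_number V E"
  unfolding thicket_number_def by (intro Max_ge finite_hitting_sizes) auto

lemma thicket_number_attained:
  assumes "finite V"
  obtains H where "thicket V E H" "hitting_size V H = thicket_number V E"
proof -
  \<comment> \<open>The empty thicket makes the range of the maximum nonempty.\<close>
  have "thicket V E {}" by (simp add: thicket_def)
  then have "thicket_number V E \<in> hitting_size V ` {H. thicket V E H}"
    unfolding thicket_number_def using assms by (intro Max_in finite_hitting_sizes) auto
  then show ?thesis using that by auto
qed

text \<open>Makes the weight 2/k in \<open>thicket_game\<close> meaningful and its family of
  coalitions nonempty.\<close>

lemma thicket_number_pos:
  assumes "finite V" "V \<noteq> {}"
  shows "0 < thicket_number V E"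
proof -
  obtain a where a: "a \<in> V" using assms(2) by blast
  have thk: "thicket V E {{a}}"
    using a by (simp add: thicket_def induced_connected_singleton)
  obtain Y where Y: "hitting_set V {{a}} Y" "card Y = hitting_size V {{a}}"
    using hitting_size_attained[OF thk] .
  then have "a \<in> Y" "finite Y"
    using assms(1) by (auto simp: hitting_set_def intro: finite_subset)
  then have "0 < card Y" by (auto simp: card_gt_0_iff)
  then show ?thesis
    using Y(2) hitting_size_le_thicket_number[OF assms(1) thk] by simp
qed

section \<open>The upper bound on the ratio\<close>

lemma kappa_le_thicket_number:
  assumes G: "simple_graph V E" and v: "coalition_game V E v"
  shows "real (kappa V v) \<le> real (thicket_number V E) * kappa_f V v"
proof -
  let ?k = "thicket_number V E"
  have fin: "finite V" and sym: "\<And>x y. E x y \<Longrightarrow> E y x"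
    using G by (auto simp: simple_graph_def)
  have v0: "v {} = 0" using v by (simp add: coalition_game_def)
  have "\<exists>T. vine E V T \<and> admissible ?k {} T"
  proof (rule admissible_vine_exists[of E V])
    fix H assume H: "thicket V E H"
    obtain Y where "hitting_set V H Y" "card Y = hitting_size V H"
      using hitting_size_attained[OF H] .
    then show "\<exists>Y\<subseteq>V. (\<forall>A\<in>H. A \<inter> Y \<noteq> {}) \<and> card Y \<le> ?k"
      using hitting_size_le_thicket_number[OF fin H]
      by (intro exI[of _ Y]) (auto simp: hitting_set_def Int_commute)
  qed (use sym fin in \<open>auto simp: thicket_def\<close>)
  then obtain T where T: "vine E V T" "admissible ?k {} T" by blast
  let ?F = "{S. S \<subseteq> V \<and> induced_connected E S}"
  \<comment> \<open>No set survives the elimination of the whole tree, so the surviving family is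
    empty.\<close>
  have "peelable ?k (?F \<union> {})"
  proof (rule peelable_vine[of T])
    fix Y assume Y: "Y \<in> set_rtree T"
    then have "Y \<subseteq> V" using T(1) unfolding vine_def verts_def by blast
    then show "finite Y \<and> card Y \<le> ?k"
      using T(2) Y fin finite_subset by (auto simp: admissible_def)
  next
    fix S assume "S \<in> ?F"
    then show "conn S T \<and> S \<subseteq> verts T \<and> S \<noteq> {}"
      using T(1) by (simp add: vine_def induced_connected_def)
  qed (auto intro: peelable.empty)
  then have "peelable ?k ?F" by simp
  then obtain x :: "'a \<Rightarrow> nat" and P where xP: "P \<subseteq> ?F" "disjoint P"
    "\<forall>S\<in>?F. v S \<le> sum x S" "sum x V \<le> ?k * sum v P"
    using peelable_cover_packing[of ?k ?F V v] fin by blast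
  have feas: "v S \<le> sum x S" if "S \<subseteq> V" for S
  proof (cases "S \<in> ?F")
    case False
    then have "v S = 0" using v that by (auto simp: coalition_game_def)
    then show ?thesis by simp
  qed (use xP(3) in blast)
  then have "kappa V v \<le> ?k * sum v P"
    using order_trans[OF kappa_le[OF feas] xP(4)] by blast
  then have "real (kappa V v) \<le> real ?k * real (sum v P)"
    by (metis of_nat_le_iff of_nat_mult)
  also have "\<dots> \<le> real ?k * kappa_f V v"
    using xP(1,2) by (intro mult_left_mono packing_le_kappa_f[where v = v and P = P] fin v0) auto
  finally show ?thesis .
qed

section \<open>The lower bound on the ratio\<close>

lemma kappa_f_ge_value:
  fixes v :: "'a set \<Rightarrow> nat"
  assumes "finite V" "v {} = 0" "S \<subseteq> V"
  shows "real (v S) \<le> kappa_f V v"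
  using packing_le_kappa_f[of V v "{S}"] assms by (simp add: disjoint_def)

lemma thicket_game:
  assumes G: "simple_graph V E" and "V \<noteq> {}"
  obtains v where "coalition_game V E v" "thicket_number V E \<le> 2 * kappa V v" "kappa_f V v \<le> 2"
proof -
  let ?k = "thicket_number V E"
  have fin: "finite V" and sym: "\<And>x y. E x y \<Longrightarrow> E y x"
    using G by (auto simp: simple_graph_def)
  have k0: "0 < ?k" by (rule thicket_number_pos[OF fin \<open>V \<noteq> {}\<close>])
  obtain H where H: "thicket V E H" "hitting_size V H = ?k"
    using thicket_number_attained[OF fin] .
  obtain W where W: "hitting_set V H W" "card W = ?k"
    using hitting_size_attained[OF H(1)] H(2) by metis
  have WV: "W \<subseteq> V" using W(1) by (simp add: hitting_set_def)
  have finW: "finite W" using finite_subset[OF WV fin] .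
  define F where "F = {S. S \<subseteq> V \<and> induced_connected E S \<and> ?k < 2 * card (S \<inter> W)}"
  have hitF: "?k \<le> 2 * card X" if X: "X \<subseteq> V" "\<And>S. S \<in> F \<Longrightarrow> S \<inter> X \<noteq> {}" for X
  proof (rule ccontr)
    assume small: "\<not> ?k \<le> 2 * card X"
    then have "card X < ?k" by linarith
    then have "\<not> hitting_set V H X" using hitting_size_le[of V H X] H(2) by linarith
    then obtain A where A: "A \<in> H" "A \<inter> X = {}" using X(1) by (auto simp: hitting_set_def)
    have HA: "B \<subseteq> V \<and> induced_connected E B" "A \<inter> B \<noteq> {}" if "B \<in> H" for B
      using H(1) that A(1) by (simp_all add: thicket_def)
    obtain a where a: "a \<in> A" using HA(2)[OF A(1)] by blast
    then have aU: "a \<in> V - X" using HA(1)[OF A(1)] A(2) by blast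
    let ?C = "component E (V - X) a"
    have CU: "?C \<subseteq> V - X" by (rule component_subset[OF aU])
    have "induced_connected E ?C" using component_connected[of E a "V - X"] sym aU by blast
    \<comment> \<open>The component avoids \<open>X\<close>, so it is not in \<open>F\<close> and
      contains at most half of \<open>W\<close>.\<close>
    then have "\<not> ?k < 2 * card (?C \<inter> W)"
      using X(2)[of ?C] CU unfolding F_def by blast
    then have "card (X \<union> (?C \<inter> W)) < ?k"
      using small card_Un_le[of X "?C \<inter> W"] by linarith
    moreover have "hitting_set V H (X \<union> (?C \<inter> W))"
      unfolding hitting_set_def
    proof (intro conjI ballI)
      show "X \<union> (?C \<inter> W) \<subseteq> V" using X(1) WV by blast
      fix B assume B: "B \<in> H"
      show "(X \<union> (?C \<inter> W)) \<inter> B \<noteq> {}"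
      proof (cases "B \<inter> X = {}")
        case True
        have AC: "A \<subseteq> ?C"
          using component_absorb[of E A "V - X" a] HA(1)[OF A(1)] A(2) a aU component_self[of a E "V - X"]
          by blast
        \<comment> \<open>\<open>B\<close> avoids \<open>X\<close> and intersects \<open>A\<close>,
          which lies in this component; so \<open>W\<close> hits \<open>B\<close> inside
          \<open>?C\<close>.\<close>
        then have "B \<subseteq> ?C"
          using component_absorb[of E B "V - X" a] HA[OF B] True aU by blast
        moreover have "W \<inter> B \<noteq> {}" using W(1) B by (simp add: hitting_set_def)
        ultimately show ?thesis by blast
      qed blast
    qed
    ultimately show False using hitting_size_le[of V H] H(2) by fastforce
  qed
  define v :: "'a set \<Rightarrow> nat" where "v S = of_bool (S \<in> F)" for S
  \<comment> \<open>The empty set is too small to hit \<open>F\<close>, so \<open>F\<close> has a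
    member.\<close>
  obtain S0 where S0: "S0 \<in> F" using hitF[of "{}"] k0 by auto
  have v0: "v {} = 0" by (simp add: v_def F_def)
  have game: "coalition_game V E v"
    unfolding coalition_game_def
  proof (intro conjI)
    show "\<exists>S\<subseteq>V. v S \<noteq> 0" using S0 by (intro exI[of _ S0]) (simp add: v_def F_def)
  qed (auto simp: v_def F_def)
  obtain x :: "'a \<Rightarrow> nat" where x: "\<And>S. S \<subseteq> V \<Longrightarrow> v S \<le> sum x S" "sum x V = kappa V v"
    using kappa_attained[of V v] fin v0 by blast
  \<comment> \<open>The support of an optimal integral cover hits all of \<open>F\<close>, and its
    size is at most the cost.\<close>
  let ?X = "{i\<in>V. x i \<noteq> 0}"
  have "?k \<le> 2 * card ?X"
  proof (rule hitF)
    fix S assume S: "S \<in> F"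
    then have "S \<subseteq> V" "0 < sum x S" using x(1)[of S] by (auto simp: v_def F_def)
    then obtain i where "i \<in> S" "x i \<noteq> 0" by (metis less_irrefl sum.neutral)
    then show "S \<inter> ?X \<noteq> {}" using \<open>S \<subseteq> V\<close> by blast
  qed auto
  also have "card ?X \<le> sum x ?X"
    using sum_mono[of ?X "\<lambda>_. 1" x] by (simp add: Suc_le_eq)
  also have "sum x ?X \<le> sum x V"
    using fin by (intro sum_mono2) auto
  finally have lower: "?k \<le> 2 * kappa V v" using x(2) by simp
  \<comment> \<open>A member of \<open>F\<close> contains more than k/2 vertices of
    \<open>W\<close>, so weight 2/k on each of them covers its value 1.\<close>
  define z :: "'a \<Rightarrow> real" where "z i = (if i \<in> W then 2 / real ?k else 0)" for i
  have sum_z: "sum z S = real (card (S \<inter> W)) * (2 / real ?k)" if "S \<subseteq> V" for S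
  proof -
    have "finite S" using that fin finite_subset by blast
    then show ?thesis unfolding z_def by (simp add: sum.If_cases)
  qed
  have "kappa_f V v \<le> sum z V"
  proof (rule kappa_f_le)
    fix S assume S: "S \<subseteq> V"
    show "real (v S) \<le> sum z S"
    proof (cases "S \<in> F")
      case True
      then have "real ?k \<le> real (2 * card (S \<inter> W))" unfolding F_def by (simp only: of_nat_le_iff) auto
      then show ?thesis using True k0 by (simp add: v_def sum_z[OF S] field_simps)
    next
      case False
      then show ?thesis by (simp add: v_def sum_z[OF S])
    qed
  qed (simp add: z_def)
  also have "sum z V = 2"
    using sum_z[of V] W(2) k0 WV by (simp add: Int_absorb1)
  finally show ?thesis using that game lower by blast
qed

lemma kappa_f_pos:
  assumes "simple_graph V E" "coalition_game V E v"
  shows "0 < kappa_f V v"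
proof -
  obtain S where S: "S \<subseteq> V" "v S \<noteq> 0" using assms(2) by (auto simp: coalition_game_def)
  then have "real (v S) \<le> kappa_f V v"
    using assms by (intro kappa_f_ge_value) (auto simp: coalition_game_def simple_graph_def)
  then show ?thesis using S(2) by linarith
qed

theorem theorem2:
  fixes V :: "'a set" and E :: "'a \<Rightarrow> 'a \<Rightarrow> bool"
  assumes "simple_graph V E" and "V \<noteq> {}"
  shows "(\<forall>v. coalition_game V E v \<longrightarrow>
            real (kappa V v) / kappa_f V v \<le> real (thicket_number V E))
       \<and> (\<exists>v. coalition_game V E v \<and>
            real (kappa V v) / kappa_f V v \<ge> real (thicket_number V E) / 4)"
proof (intro conjI allI impI)
  fix v assume v: "coalition_game V E v"
  show "real (kappa V v) / kappa_f V v \<le> real (thicket_number V E)"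
    using kappa_le_thicket_number[OF assms(1) v] kappa_f_pos[OF assms(1) v]
    by (simp add: divide_le_eq)
next
  obtain v where v: "coalition_game V E v" "thicket_number V E \<le> 2 * kappa V v" "kappa_f V v \<le> 2"
    using thicket_game[OF assms] .
  have "real (thicket_number V E) \<le> real (2 * kappa V v)"
    using v(2) by (simp only: of_nat_le_iff)
  then have "real (thicket_number V E) / 4 \<le> real (kappa V v) / 2" by simp
  also have "\<dots> \<le> real (kappa V v) / kappa_f V v"
    using v(3) kappa_f_pos[OF assms(1) v(1)] by (intro divide_left_mono) auto
  finally show "\<exists>v. coalition_game V E v \<and>
      real (kappa V v) / kappa_f V v \<ge> real (thicket_number V E) / 4"
    using v(1) by blast
qed

end
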